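(* In the Poisson arrival model, $\mathrm{OPT}\le\mathrm{NAT}$.
   Context: Let $I$ be a finite set of online vertex types and $J$ a finite set of offline vertices. For $i\in I$, $j\in J$, $w_{ij}\ge 0$ is the weight of matching an online vertex of type $i$ to $j$. Type $i$ has arrival rate $\lambda_i>0$, and $\Lambda=\sum_{i\in I}\lambda_i$. Poisson arrival model: the online vertices of each type $i$ arrive over the time interval $[0,1]$ according to independent Poisson processes of rate $\lambda_i$ (equivalently, the number of online vertices is Poisson with mean $\Lambda$, and each independently has type $i$ with probability $\lambda_i/\Lambda$). $\mathrm{OPT}$ is the expected total weight of the maximum weight matching in the realized bipartite graph between online vertices and $J$. $\mathrm{NAT}$ is the optimal value of the natural linear program: maximize $\sum_{i\in I}\sum_{j\in J}w_{ij}x_{ij}$ subject to $\sum_{j\in J}x_{ij}\le\lambda_i$ for all $i\in I$; $\sum_{i\in S}x_{ij}\le 1-\exp\big(-\sum_{i\in S}\lambda_i\big)$ for all $j\in J$ and all $S\subseteq I$; and $x_{ij}\ge0$ for all $i\in I$, $j\in J$. *)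

theory Defs
  imports "HOL-Probability.Probability"
begin

definition unit_borel :: "real set set" where
  "unit_borel = {B \<in> sets borel. B \<subseteq> {0..1}}"

text \<open>A Poisson process is represented by its random set of arrival times.  The case
  \<open>measure lborel B = 0\<close> is why the law of the counts is written out: the library's
  \<open>poisson_pmf\<close> is specified only for positive rates.\<close>

definition poisson_process :: "'a measure \<Rightarrow> real \<Rightarrow> ('a \<Rightarrow> real set) \<Rightarrow> bool" where
  "poisson_process M r A \<longleftrightarrow>
     (\<forall>\<omega>\<in>space M. finite (A \<omega>) \<and> A \<omega> \<subseteq> {0..1}) \<and>
     (\<forall>B\<in>unit_borel. \<forall>k. measure M {\<omega> \<in> space M. card (A \<omega> \<inter> B) = k} =
        exp (- (r * measure lborel B)) * (r * measure lborel B) ^ k / fact k) \<and>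
     (\<forall>F. finite F \<and> F \<subseteq> unit_borel \<and> disjoint F \<longrightarrow>
        prob_space.indep_vars M (\<lambda>_. count_space UNIV) (\<lambda>B \<omega>. card (A \<omega> \<inter> B)) F)"

text \<open>Independence between types is independence of the whole processes, each identified with
  the family of its counts on the Borel subsets of the unit interval.\<close>

definition poisson_arrivals ::
  "'a measure \<Rightarrow> 'i set \<Rightarrow> ('i \<Rightarrow> real) \<Rightarrow> ('i \<Rightarrow> 'a \<Rightarrow> real set) \<Rightarrow> bool" where
  "poisson_arrivals M I lam arr \<longleftrightarrow>
     (\<forall>i\<in>I. poisson_process M (lam i) (arr i)) \<and>
     prob_space.indep_vars M (\<lambda>_. PiM unit_borel (\<lambda>_. count_space UNIV))
       (\<lambda>i \<omega>. \<lambda>B\<in>unit_borel. card (arr i \<omega> \<inter> B)) I"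

text \<open>An online vertex is a pair of its type and its arrival time.\<close>

definition online_vertices :: "'i set \<Rightarrow> ('i \<Rightarrow> 'a \<Rightarrow> real set) \<Rightarrow> 'a \<Rightarrow> ('i \<times> real) set" where
  "online_vertices I arr \<omega> = (SIGMA i:I. arr i \<omega>)"

definition is_matching :: "'v set \<Rightarrow> 'j set \<Rightarrow> ('v \<times> 'j) set \<Rightarrow> bool" where
  "is_matching V J E \<longleftrightarrow> E \<subseteq> V \<times> J \<and> inj_on fst E \<and> inj_on snd E"

definition matching_weight :: "('i \<Rightarrow> 'j \<Rightarrow> real) \<Rightarrow> (('i \<times> real) \<times> 'j) set \<Rightarrow> real" where
  "matching_weight w E = (\<Sum>((i, t), j)\<in>E. w i j)"

definition max_matching_weight ::
  "('i \<Rightarrow> 'j \<Rightarrow> real) \<Rightarrow> ('i \<times> real) set \<Rightarrow> 'j set \<Rightarrow> real" where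
  "max_matching_weight w V J = Max (matching_weight w ` {E. is_matching V J E})"

definition OPT ::
  "'a measure \<Rightarrow> 'i set \<Rightarrow> 'j set \<Rightarrow> ('i \<Rightarrow> 'j \<Rightarrow> real) \<Rightarrow> ('i \<Rightarrow> 'a \<Rightarrow> real set) \<Rightarrow> real" where
  "OPT M I J w arr = (LINT \<omega>|M. max_matching_weight w (online_vertices I arr \<omega>) J)"

definition NAT_feasible ::
  "'i set \<Rightarrow> 'j set \<Rightarrow> ('i \<Rightarrow> real) \<Rightarrow> ('i \<Rightarrow> 'j \<Rightarrow> real) \<Rightarrow> bool" where
  "NAT_feasible I J lam x \<longleftrightarrow>
     (\<forall>i\<in>I. (\<Sum>j\<in>J. x i j) \<le> lam i) \<and>
     (\<forall>j\<in>J. \<forall>S\<subseteq>I. (\<Sum>i\<in>S. x i j) \<le> 1 - exp (- (\<Sum>i\<in>S. lam i))) \<and>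
     (\<forall>i\<in>I. \<forall>j\<in>J. x i j \<ge> 0)"

definition NAT :: "'i set \<Rightarrow> 'j set \<Rightarrow> ('i \<Rightarrow> real) \<Rightarrow> ('i \<Rightarrow> 'j \<Rightarrow> real) \<Rightarrow> real" where
  "NAT I J lam w = Sup {(\<Sum>i\<in>I. \<Sum>j\<in>J. w i j * x i j) | x. NAT_feasible I J lam x}"

end

theory Submission
  imports Defs
begin

text \<open>The weight of a maximum matching depends only on the number of arrivals of each type, so a
  maximum matching can be chosen as a function of these counts. Let \<open>x i j\<close> be the expected number
  of type \<open>i\<close> vertices which it matches to \<open>j\<close>. The expected number of arrivals of type \<open>i\<close> is
  \<open>lam i\<close>, and \<open>j\<close> is matched at most once to types in \<open>S\<close>, and never when no vertex
  with type in \<open>S\<close> arrives, which has probability \<open>exp (- (\<Sum>i\<in>S. lam i))\<close>. Hence \<open>x\<close> is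
  feasible for the linear program, and its objective value is \<open>OPT\<close>.\<close>

section \<open>Matchings counted by online type and offline vertex\<close>

text \<open>For a single realization these numbers play the role of the variables of the linear
  program; the second component of an online vertex is forgotten.\<close>

definition match_count :: "(('i \<times> 't) \<times> 'j) set \<Rightarrow> 'i \<Rightarrow> 'j \<Rightarrow> nat" where
  "match_count E i j = card {e \<in> E. fst (fst e) = i \<and> snd e = j}"

lemma is_matching_finite:
  assumes "is_matching V J E" "finite V" "finite J"
  shows "finite E"
  using assms unfolding is_matching_def by (meson finite_SigmaI finite_subset)

lemma finite_matchings:
  assumes "finite V" "finite J"
  shows "finite {E. is_matching V J E}"
proof (rule finite_subset)
  show "{E. is_matching V J E} \<subseteq> Pow (V \<times> J)"
    by (auto simp: is_matching_def)
qed (use assms in simp)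

lemma is_matching_empty: "is_matching V J {}"
  by (simp add: is_matching_def)

text \<open>An edge weight ignores the arrival time, so edges may be grouped by type and offline
  vertex. This brings the weight into the form of the objective of the linear program.\<close>

lemma matching_weight_eq_sum_match_count:
  assumes "finite I" "finite J" "\<And>i. i \<in> I \<Longrightarrow> finite (A i)" "is_matching (Sigma I A) J E"
  shows "matching_weight w E = (\<Sum>i\<in>I. \<Sum>j\<in>J. w i j * real (match_count E i j))"
proof -
  define g where "g = (\<lambda>e :: ('a \<times> real) \<times> 'b. (fst (fst e), snd e))"
  have E: "E \<subseteq> Sigma I A \<times> J"
    using assms(4) by (simp add: is_matching_def)
  have "finite E"
    using is_matching_finite[OF assms(4)] assms(1-3) by simp
  have "matching_weight w E = (\<Sum>e\<in>E. case_prod w (g e))"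
    by (auto simp: matching_weight_def g_def case_prod_beta)
  also have "\<dots> = (\<Sum>y\<in>I \<times> J. \<Sum>e\<in>{e \<in> E. g e = y}. case_prod w (g e))"
    by (rule sum.group[symmetric]) (use E assms \<open>finite E\<close> in \<open>auto simp: g_def\<close>)
  also have "\<dots> = (\<Sum>y\<in>I \<times> J. case_prod w y * real (match_count E (fst y) (snd y)))"
  proof (rule sum.cong[OF refl])
    fix y :: "'a \<times> 'b"
    have "(\<Sum>e\<in>{e \<in> E. g e = y}. case_prod w (g e)) = real (card {e \<in> E. g e = y}) * case_prod w y"
      by simp
    moreover have "{e \<in> E. g e = y} = {e \<in> E. fst (fst e) = fst y \<and> snd e = snd y}"
      by (auto simp: g_def)
    ultimately show "(\<Sum>e\<in>{e \<in> E. g e = y}. case_prod w (g e))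
        = case_prod w y * real (match_count E (fst y) (snd y))"
      by (simp add: match_count_def)
  qed
  finally show ?thesis
    by (simp add: sum.cartesian_product case_prod_beta)
qed

text \<open>Every online vertex lies on at most one edge, so the edges at type \<open>i\<close>
  inject into \<open>A i\<close>.\<close>

lemma sum_match_count_offline_le:
  assumes "finite J" "finite (A i)" "is_matching (Sigma I A) J E"
  shows "(\<Sum>j\<in>J. match_count E i j) \<le> card (A i)"
proof -
  let ?E = "{e \<in> E. fst (fst e) = i}"
  have E: "E \<subseteq> Sigma I A \<times> J" and inj: "inj_on fst E"
    using assms(3) by (simp_all add: is_matching_def)
  have "finite ?E"
    by (rule finite_subset[of _ "({i} \<times> A i) \<times> J"]) (use assms E in auto)
  have "(\<Sum>j\<in>J. match_count E i j) = (\<Sum>j\<in>J. \<Sum>e\<in>{e \<in> ?E. snd e = j}. 1)"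
    by (simp add: match_count_def conj_assoc)
  also have "\<dots> = (\<Sum>e\<in>?E. 1)"
    by (rule sum.group) (use E assms \<open>finite ?E\<close> in auto)
  also have "\<dots> = card ?E"
    by simp
  also have "\<dots> \<le> card (A i)"
  proof (rule card_inj_on_le)
    \<comment> \<open>Within the fixed type \<open>i\<close> the time alone determines the online
      vertex, and injectivity of \<open>fst\<close> on \<open>E\<close> then determines the
      edge.\<close>
    show "inj_on (snd \<circ> fst) ?E"
    proof (rule inj_onI)
      fix e e' assume *: "e \<in> ?E" "e' \<in> ?E" "(snd \<circ> fst) e = (snd \<circ> fst) e'"
      then have "fst e = fst e'"
        by (auto simp: prod_eq_iff)
      with * inj show "e = e'"
        by (auto dest: inj_onD)
    qed
  qed (use E assms in auto)
  finally show ?thesis .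
qed

text \<open>The offline vertex \<open>j\<close> lies on at most one edge, and on no edge to a type
  in \<open>S\<close> if none of these types has a vertex.\<close>

lemma sum_match_count_online_le:
  assumes "finite S" "finite (Sigma I A)" "finite J" "is_matching (Sigma I A) J E"
  shows "(\<Sum>i\<in>S. match_count E i j) \<le> of_bool (\<exists>i\<in>S. A i \<noteq> {})"
proof -
  let ?E = "{e \<in> E. fst (fst e) \<in> S \<and> snd e = j}"
  have E: "E \<subseteq> Sigma I A \<times> J" and inj: "inj_on snd E"
    using assms(4) by (simp_all add: is_matching_def)
  have "finite ?E"
    using is_matching_finite[OF assms(4,2,3)] by simp
  have "(\<Sum>i\<in>S. match_count E i j) = (\<Sum>i\<in>S. \<Sum>e\<in>{e \<in> ?E. fst (fst e) = i}. 1)"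
    by (auto simp: match_count_def intro!: sum.cong arg_cong[where f = card])
  also have "\<dots> = (\<Sum>e\<in>?E. 1)"
    by (rule sum.group) (use assms \<open>finite ?E\<close> in auto)
  also have "\<dots> = card ?E"
    by simp
  also have "\<dots> \<le> of_bool (\<exists>i\<in>S. A i \<noteq> {})"
  proof (cases "\<exists>i\<in>S. A i \<noteq> {}")
    case True
    have "card ?E \<le> 1"
    proof -
      have "card ?E \<le> card {j}"
        by (rule card_inj_on_le[where f = snd]) (use inj in \<open>auto intro: inj_on_subset\<close>)
      then show ?thesis by simp
    qed
    moreover have "of_bool (\<exists>i\<in>S. A i \<noteq> {}) = (1::nat)"
      using True by (simp only: of_bool_eq)
    ultimately show ?thesis by linarith
  next
    case False
    then have "?E = {}" using E by fastforce
    then show ?thesis by (simp only: card.empty le0)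
  qed
  finally show ?thesis .
qed

section \<open>The maximum weight as a function of the counts\<close>

text \<open>Vertices of one type are interchangeable: relabelling arrival times within each type
  carries a matching to a matching of the same weight. One inclusion suffices, since the inverse
  relabelling gives the other.\<close>

lemma matching_weights_subset_of_bij_betw:
  assumes f: "\<And>i. i \<in> I \<Longrightarrow> bij_betw (f i) (A i) (B i)"
  shows "matching_weight w ` {E. is_matching (Sigma I A) J E}
    \<subseteq> matching_weight w ` {E. is_matching (Sigma I B) J E}"
proof
  fix y assume "y \<in> matching_weight w ` {E. is_matching (Sigma I A) J E}"
  then obtain E where E: "E \<subseteq> Sigma I A \<times> J" "inj_on fst E" "inj_on snd E"
    and y: "y = matching_weight w E"
    by (auto simp: is_matching_def)
  define h where "h = (\<lambda>v :: 'a \<times> real. (fst v, f (fst v) (snd v)))"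
  define g where "g = (\<lambda>e :: ('a \<times> real) \<times> 'b. (h (fst e), snd e))"
  have inj_h: "inj_on h (Sigma I A)"
    using f unfolding h_def inj_on_def bij_betw_def by auto
  \<comment> \<open>An edge is determined by its relabelled online endpoint. This yields both
    injectivity of \<open>g\<close> on \<open>E\<close> and the online matching condition for the
    image.\<close>
  have h_fst: "h (fst e) = h (fst e') \<Longrightarrow> e = e'" if "e \<in> E" "e' \<in> E" for e e'
  proof -
    assume eq: "h (fst e) = h (fst e')"
    have "fst e \<in> Sigma I A" "fst e' \<in> Sigma I A"
      using that E(1) by auto
    with eq inj_h have "fst e = fst e'"
      by (auto dest: inj_onD)
    with that E(2) show "e = e'"
      by (auto dest: inj_onD)
  qed
  have inj_g: "inj_on g E"
  proof (rule inj_onI)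
    fix e e' assume "e \<in> E" "e' \<in> E" "g e = g e'"
    then show "e = e'"
      using h_fst[of e e'] by (simp add: g_def)
  qed
  have "g ` E \<subseteq> Sigma I B \<times> J"
  proof
    fix x assume "x \<in> g ` E"
    then obtain i t j where "x = ((i, f i t), j)" "((i, t), j) \<in> E"
      by (force simp: g_def h_def)
    with E(1) f show "x \<in> Sigma I B \<times> J"
      by (auto simp: bij_betw_def)
  qed
  moreover have "inj_on fst (g ` E)"
  proof (rule inj_onI; elim imageE)
    fix x x' e e' assume "fst x = fst x'" "x = g e" "e \<in> E" "x' = g e'" "e' \<in> E"
    then have "e = e'"
      using h_fst[of e e'] by (simp add: g_def)
    then show "x = x'"
      using \<open>x = g e\<close> \<open>x' = g e'\<close> by simp
  qed
  moreover have "inj_on snd (g ` E)"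
  proof (rule inj_onI; elim imageE)
    fix x x' e e' assume "snd x = snd x'" "x = g e" "e \<in> E" "x' = g e'" "e' \<in> E"
    then have "e = e'"
      using inj_onD[OF E(3), of e e'] by (simp add: g_def)
    then show "x = x'"
      using \<open>x = g e\<close> \<open>x' = g e'\<close> by simp
  qed
  ultimately have "is_matching (Sigma I B) J (g ` E)"
    by (simp add: is_matching_def)
  moreover have "matching_weight w (g ` E) = y"
    unfolding y matching_weight_def sum.reindex[OF inj_g]
    by (intro sum.cong) (auto simp: g_def h_def)
  ultimately show "y \<in> matching_weight w ` {E. is_matching (Sigma I B) J E}"
    by blast
qed

lemma max_matching_weight_cong_card:
  assumes "\<And>i. i \<in> I \<Longrightarrow> finite (A i)" "\<And>i. i \<in> I \<Longrightarrow> finite (B i)"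
    and "\<And>i. i \<in> I \<Longrightarrow> card (A i) = card (B i)"
  shows "max_matching_weight w (Sigma I A) J = max_matching_weight w (Sigma I B) J"
proof -
  have "\<forall>i\<in>I. \<exists>f. bij_betw f (A i) (B i)" "\<forall>i\<in>I. \<exists>f. bij_betw f (B i) (A i)"
    using assms by (simp_all add: finite_same_card_bij)
  then obtain f f' where "\<And>i. i \<in> I \<Longrightarrow> bij_betw (f i) (A i) (B i)"
      "\<And>i. i \<in> I \<Longrightarrow> bij_betw (f' i) (B i) (A i)"
    by metis
  then have "matching_weight w ` {E. is_matching (Sigma I A) J E}
      = matching_weight w ` {E. is_matching (Sigma I B) J E}"
    by (intro subset_antisym matching_weights_subset_of_bij_betw) auto
  then show ?thesis
    by (simp add: max_matching_weight_def)
qed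

lemma max_matching_weight_attained:
  assumes "finite V" "finite J"
  shows "\<exists>E. is_matching V J E \<and> matching_weight w E = max_matching_weight w V J"
proof -
  have "max_matching_weight w V J \<in> matching_weight w ` {E. is_matching V J E}"
    unfolding max_matching_weight_def
    by (rule Max_in) (use finite_matchings[OF assms] is_matching_empty[of V J] in auto)
  then show ?thesis by auto
qed

text \<open>Values below the counts serve as surrogate arrival times, which makes the matching a
  function of the counts alone.\<close>

definition count_matching ::
  "'i set \<Rightarrow> 'j set \<Rightarrow> ('i \<Rightarrow> 'j \<Rightarrow> real) \<Rightarrow> ('i \<Rightarrow> nat) \<Rightarrow> (('i \<times> real) \<times> 'j) set" where
  "count_matching I J w n = (let V = (SIGMA i:I. real ` {..<n i}) in
     SOME E. is_matching V J E \<and> matching_weight w E = max_matching_weight w V J)"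

lemma count_matching:
  assumes "finite I" "finite J"
  shows "is_matching (SIGMA i:I. real ` {..<n i}) J (count_matching I J w n)"
    and "matching_weight w (count_matching I J w n)
      = max_matching_weight w (SIGMA i:I. real ` {..<n i}) J"
proof -
  let ?V = "SIGMA i:I. real ` {..<n i}"
  have "finite ?V" using assms by simp
  from someI_ex[OF max_matching_weight_attained[OF this assms(2), of w]]
  show "is_matching ?V J (count_matching I J w n)"
    and "matching_weight w (count_matching I J w n) = max_matching_weight w ?V J"
    by (simp_all add: count_matching_def Let_def)
qed

text \<open>The surrogate vertex set has exactly \<open>n i\<close> vertices of each type, so it has
  the same maximum weight as the actual one. The right-hand side no longer depends on the arrival
  times.\<close>

lemma max_matching_weight_eq_count_matching:
  assumes "finite I" "finite J" "\<And>i. i \<in> I \<Longrightarrow> finite (A i)" "\<And>i. i \<in> I \<Longrightarrow> card (A i) = n i"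
  shows "max_matching_weight w (Sigma I A) J
    = (\<Sum>i\<in>I. \<Sum>j\<in>J. w i j * real (match_count (count_matching I J w n) i j))"
proof -
  have "max_matching_weight w (Sigma I A) J = matching_weight w (count_matching I J w n)"
    unfolding count_matching(2)[OF assms(1,2)]
    by (rule max_matching_weight_cong_card) (use assms in \<open>auto simp: card_image\<close>)
  also have "\<dots> = (\<Sum>i\<in>I. \<Sum>j\<in>J. w i j * real (match_count (count_matching I J w n) i j))"
    by (rule matching_weight_eq_sum_match_count[OF assms(1,2) _ count_matching(1)[OF assms(1,2)]])
      simp
  finally show ?thesis .
qed

section \<open>Boundedness of the linear program\<close>

text \<open>A real supremum bounds its elements only if the set is bounded above. The constraints
  for singletons \<open>S = {i}\<close> give \<open>x i j \<le> 1\<close>, and with nonnegative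
  weights the objective is at most the sum of all weights.\<close>

lemma NAT_upper:
  assumes "finite I" "finite J"
    and "\<And>i j. i \<in> I \<Longrightarrow> j \<in> J \<Longrightarrow> w i j \<ge> 0"
    and "NAT_feasible I J lam x"
  shows "(\<Sum>i\<in>I. \<Sum>j\<in>J. w i j * x i j) \<le> NAT I J lam w"
  unfolding NAT_def
proof (rule cSup_upper)
  show "bdd_above {\<Sum>i\<in>I. \<Sum>j\<in>J. w i j * x i j |x. NAT_feasible I J lam x}"
  proof (rule bdd_aboveI)
    fix z assume "z \<in> {\<Sum>i\<in>I. \<Sum>j\<in>J. w i j * x i j |x. NAT_feasible I J lam x}"
    then obtain y where z: "z = (\<Sum>i\<in>I. \<Sum>j\<in>J. w i j * y i j)" and y: "NAT_feasible I J lam y"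
      by auto
    have "y i j \<le> 1" if "i \<in> I" "j \<in> J" for i j
    proof -
      have "(\<Sum>i\<in>{i}. y i j) \<le> 1 - exp (- (\<Sum>i\<in>{i}. lam i))"
        using y that unfolding NAT_feasible_def by blast
      then show ?thesis
        using exp_ge_zero[of "- lam i"] by (simp del: exp_ge_zero)
    qed
    then show "z \<le> (\<Sum>i\<in>I. \<Sum>j\<in>J. w i j * 1)"
      unfolding z by (intro sum_mono mult_left_mono) (use assms in auto)
  qed
qed (use assms in auto)

section \<open>Poisson counts: mean, independence, measurability\<close>

lemma poisson_sums_mean:
  fixes r :: real
  shows "(\<lambda>k. r ^ k / fact k * exp (- r) * real k) sums r"
proof -
  have "(\<lambda>k. r ^ k / fact k) sums exp r"
    using exp_converges[of r] by (simp add: field_simps)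
  then have "(\<lambda>k. r ^ k / fact k * (r * exp (- r))) sums (exp r * (r * exp (- r)))"
    by (rule sums_mult2)
  also have "exp r * (r * exp (- r)) = r"
    by (simp add: exp_minus)
  \<comment> \<open>The factor \<open>k + 1\<close> cancels against the factorial, so the
    exponential series times \<open>r * exp (- r)\<close> is the mean series shifted by one. The
    term dropped by the shift, at index 0, vanishes because of the factor
    \<open>real k\<close>.\<close>
  also have "(\<lambda>k. r ^ k / fact k * (r * exp (- r)))
      = (\<lambda>k. r ^ Suc k / fact (Suc k) * exp (- r) * real (Suc k))"
    by (auto simp: fun_eq_iff field_simps simp del: of_nat_Suc)
  finally show ?thesis
    by (subst (asm) sums_Suc_iff) simp
qed

text \<open>The point probabilities identify the law of \<open>N\<close> with
  \<open>poisson_pmf r\<close>. Since \<open>N\<close> is nonnegative, the finite value of its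
  extended integral gives integrability and the mean together.\<close>

lemma (in prob_space) poisson_mean:
  fixes N :: "'a \<Rightarrow> nat"
  assumes N: "N \<in> measurable M (count_space UNIV)" and "r > 0"
    and P: "\<And>k. prob {\<omega> \<in> space M. N \<omega> = k} = exp (- r) * r ^ k / fact k"
  shows "integrable M (\<lambda>\<omega>. real (N \<omega>))" "expectation (\<lambda>\<omega>. real (N \<omega>)) = r"
proof -
  have distr: "distr M (count_space UNIV) N = measure_pmf (poisson_pmf r)"
  proof (rule measure_eqI_countable[where A = UNIV])
    fix k :: nat
    have "emeasure (distr M (count_space UNIV) N) {k} = prob {\<omega> \<in> space M. N \<omega> = k}"
      using N by (subst emeasure_distr)
        (auto simp: emeasure_eq_measure intro!: arg_cong[where f = prob])
    also have "\<dots> = pmf (poisson_pmf r) k"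
      using \<open>r > 0\<close> by (simp add: P)
    finally show "emeasure (distr M (count_space UNIV) N) {k} = emeasure (poisson_pmf r) {k}"
      by (simp add: emeasure_pmf_single)
  qed auto
  have "(\<integral>\<^sup>+\<omega>. ennreal (real (N \<omega>)) \<partial>M)
      = (\<integral>\<^sup>+k. ennreal (real k) \<partial>distr M (count_space UNIV) N)"
    using N by (subst nn_integral_distr) auto
  also have "\<dots> = (\<Sum>k. ennreal (r ^ k / fact k * exp (- r) * real k))"
    using \<open>r > 0\<close>
    unfolding distr nn_integral_measure_pmf nn_integral_count_space_nat
    by (simp only: ennreal_mult''[OF of_nat_0_le_iff] pmf_poisson)
  also have "\<dots> = ennreal r"
    by (rule suminf_ennreal_eq) (use \<open>r > 0\<close> poisson_sums_mean in auto)
  finally have nn: "(\<integral>\<^sup>+\<omega>. ennreal (real (N \<omega>)) \<partial>M) = ennreal r" .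
  have [measurable]: "(\<lambda>\<omega>. real (N \<omega>)) \<in> borel_measurable M"
    using measurable_compose[OF N, of real borel] by simp
  show "integrable M (\<lambda>\<omega>. real (N \<omega>))" "expectation (\<lambda>\<omega>. real (N \<omega>)) = r"
    using nn_integral_eq_integrable[of "\<lambda>\<omega>. real (N \<omega>)" M r] nn \<open>r > 0\<close> by auto
qed

text \<open>Independence only sees preimages intersected with \<open>space M\<close>. This form is
  needed because arrivals are known to lie in the unit interval only for outcomes in
  \<open>space M\<close>.\<close>

lemma (in prob_space) indep_vars_cong_space:
  assumes "\<And>i \<omega>. i \<in> I \<Longrightarrow> \<omega> \<in> space M \<Longrightarrow> X i \<omega> = Y i \<omega>"
  shows "indep_vars M' X I \<longleftrightarrow> indep_vars M' Y I"
proof -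
  have "X i -` A \<inter> space M = Y i -` A \<inter> space M" if "i \<in> I" for i A
    using assms that by auto
  moreover have "X i \<in> measurable M (M' i) \<longleftrightarrow> Y i \<in> measurable M (M' i)" if "i \<in> I" for i
    by (rule measurable_cong) (use assms that in auto)
  ultimately show ?thesis
    unfolding indep_vars_def2 by (intro conj_cong ball_cong indep_sets_cong) auto
qed

text \<open>The total number of arrivals is the count on the Borel set \<open>{0..1}\<close>, which
  has Lebesgue measure 1.\<close>

lemma poisson_arrivals_card:
  assumes "prob_space M" "poisson_arrivals M I lam arr"
  shows "\<And>i \<omega>. i \<in> I \<Longrightarrow> \<omega> \<in> space M \<Longrightarrow> finite (arr i \<omega>)"
    and "\<And>i k. i \<in> I \<Longrightarrow> measure M {\<omega> \<in> space M. card (arr i \<omega>) = k}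
      = exp (- lam i) * lam i ^ k / fact k"
    and "prob_space.indep_vars M (\<lambda>_. count_space UNIV) (\<lambda>i \<omega>. card (arr i \<omega>)) I"
proof -
  interpret prob_space M by fact
  have unit: "{0..1} \<in> unit_borel"
    by (simp add: unit_borel_def)
  have pp: "poisson_process M (lam i) (arr i)" if "i \<in> I" for i
    using assms(2) that by (simp add: poisson_arrivals_def)
  show "\<And>i \<omega>. i \<in> I \<Longrightarrow> \<omega> \<in> space M \<Longrightarrow> finite (arr i \<omega>)"
    using pp by (auto simp: poisson_process_def)
  have Int: "arr i \<omega> \<inter> {0..1} = arr i \<omega>" if "i \<in> I" "\<omega> \<in> space M" for i \<omega>
    using pp[OF that(1)] that(2) by (auto simp: poisson_process_def)
  show "prob {\<omega> \<in> space M. card (arr i \<omega>) = k} = exp (- lam i) * lam i ^ k / fact k"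
    if "i \<in> I" for i k
  proof -
    have "prob {\<omega> \<in> space M. card (arr i \<omega>) = k} = prob {\<omega> \<in> space M. card (arr i \<omega> \<inter> {0..1}) = k}"
      using Int that by (metis (mono_tags, lifting))
    also have "\<dots> = exp (- (lam i * measure lborel {0..1::real})) *
        (lam i * measure lborel {0..1::real}) ^ k / fact k"
      using pp[OF that] unit unfolding poisson_process_def by blast
    finally show ?thesis by simp
  qed
  have "indep_vars (\<lambda>_. PiM unit_borel (\<lambda>_. count_space UNIV))
      (\<lambda>i \<omega>. \<lambda>B\<in>unit_borel. card (arr i \<omega> \<inter> B)) I"
    using assms(2) by (simp add: poisson_arrivals_def)
  \<comment> \<open>Evaluation at the coordinate \<open>{0..1}\<close> is measurable on the product
    space, so independence of the count families passes to the total counts.\<close>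
  then have "indep_vars (\<lambda>_. count_space UNIV)
      (\<lambda>i \<omega>. (\<lambda>B\<in>unit_borel. card (arr i \<omega> \<inter> B)) {0..1}) I"
    by (rule indep_vars_compose2[where Y = "\<lambda>_ f. f {0..1}"])
      (use unit in \<open>auto intro: measurable_component_singleton\<close>)
  then show "indep_vars (\<lambda>_. count_space UNIV) (\<lambda>i \<omega>. card (arr i \<omega>)) I"
    by (rule iffD1[OF indep_vars_cong_space, rotated]) (use unit Int in simp)
qed

text \<open>For finite \<open>I\<close> there are only countably many count vectors, so it suffices
  to check singletons. With the discrete sigma-algebra on the target, every function of the counts
  becomes measurable, even a matching selected by choice.\<close>

lemma measurable_restrict_count_space:
  assumes "finite I" "\<And>i. i \<in> I \<Longrightarrow> N i \<in> measurable M (count_space (UNIV :: nat set))"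
  shows "(\<lambda>\<omega>. \<lambda>i\<in>I. N i \<omega>) \<in> measurable M (count_space (PiE I (\<lambda>_. UNIV)))"
proof (subst measurable_count_space_eq_countable)
  show "countable (PiE I (\<lambda>_. UNIV :: nat set))"
    using assms(1) by (intro countable_PiE) auto
  have "(\<lambda>\<omega>. \<lambda>i\<in>I. N i \<omega>) -` {n} \<inter> space M \<in> sets M" if n: "n \<in> PiE I (\<lambda>_. UNIV)" for n
  proof -
    have "(\<lambda>\<omega>. \<lambda>i\<in>I. N i \<omega>) -` {n} \<inter> space M = {\<omega> \<in> space M. \<forall>i\<in>I. N i \<omega> = n i}"
      using n by (auto simp: fun_eq_iff PiE_def extensional_def)
    also have "\<dots> \<in> sets M"
    proof (rule sets.sets_Collect_finite_All[OF _ assms(1)])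
      fix i assume "i \<in> I"
      have "N i -` {n i} \<inter> space M \<in> sets M"
        by (rule measurable_sets[OF assms(2)[OF \<open>i \<in> I\<close>]]) simp
      then show "{\<omega> \<in> space M. N i \<omega> = n i} \<in> sets M"
        by (simp add: vimage_def Int_def conj_commute)
    qed
    finally show ?thesis .
  qed
  then show "(\<lambda>\<omega>. \<lambda>i\<in>I. N i \<omega>) \<in> space M \<rightarrow> PiE I (\<lambda>_. UNIV) \<and>
      (\<forall>a\<in>PiE I (\<lambda>_. UNIV). (\<lambda>\<omega>. \<lambda>i\<in>I. N i \<omega>) -` {a} \<inter> space M \<in> sets M)"
    by auto
qed

lemma (in prob_space) prob_all_zero:
  fixes N :: "'i \<Rightarrow> 'a \<Rightarrow> nat"
  assumes indep: "indep_vars (\<lambda>_. count_space UNIV) N I" and "finite S" "S \<subseteq> I"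
    and zero: "\<And>i. i \<in> S \<Longrightarrow> prob {\<omega> \<in> space M. N i \<omega> = 0} = exp (- lam i)"
  shows "prob {\<omega> \<in> space M. \<forall>i\<in>S. N i \<omega> = 0} = exp (- (\<Sum>i\<in>S. lam i))"
proof (cases "S = {}")
  \<comment> \<open>The empty set is treated apart: the product rule for independence requires a
    nonempty index set, and an empty intersection would be \<open>UNIV\<close> instead of
    \<open>space M\<close>.\<close>
  case True
  then show ?thesis by (simp add: prob_space)
next
  case False
  have "{\<omega> \<in> space M. \<forall>i\<in>S. N i \<omega> = 0} = (\<Inter>i\<in>S. N i -` {0} \<inter> space M)"
    using False by auto
  also have "prob \<dots> = (\<Prod>i\<in>S. prob (N i -` {0} \<inter> space M))"
    by (rule indep_varsD[OF indep]) (use assms False in auto)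
  also have "\<dots> = (\<Prod>i\<in>S. exp (- lam i))"
  proof (rule prod.cong[OF refl])
    fix i assume "i \<in> S"
    have "N i -` {0} \<inter> space M = {\<omega> \<in> space M. N i \<omega> = 0}" by auto
    then show "prob (N i -` {0} \<inter> space M) = exp (- lam i)"
      using zero[OF \<open>i \<in> S\<close>] by simp
  qed
  also have "\<dots> = exp (- (\<Sum>i\<in>S. lam i))"
    using \<open>finite S\<close> by (simp add: exp_sum sum_negf[symmetric])
  finally show ?thesis .
qed

section \<open>The expected matching as a feasible point\<close>

theorem theorem3:
  fixes M :: "'a measure"
    and I :: "'i set" and J :: "'j set"
    and lam :: "'i \<Rightarrow> real" and w :: "'i \<Rightarrow> 'j \<Rightarrow> real"
    and arr :: "'i \<Rightarrow> 'a \<Rightarrow> real set"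
  assumes "finite I" and "finite J"
    and "\<And>i j. i \<in> I \<Longrightarrow> j \<in> J \<Longrightarrow> w i j \<ge> 0"
    and "\<And>i. i \<in> I \<Longrightarrow> lam i > 0"
    and "prob_space M"
    and "poisson_arrivals M I lam arr"
  shows "OPT M I J w arr \<le> NAT I J lam w"
proof -
  interpret prob_space M by fact
  define N where "N = (\<lambda>i \<omega>. card (arr i \<omega>))"
  note arrivals = poisson_arrivals_card[OF assms(5,6)]
  have indep: "indep_vars (\<lambda>_. count_space UNIV) N I"
    using arrivals(3) by (simp add: N_def)
  have prob_N: "prob {\<omega> \<in> space M. N i \<omega> = k} = exp (- lam i) * lam i ^ k / fact k"
    if "i \<in> I" for i k
    using arrivals(2)[OF that] by (simp add: N_def)
  have N_meas [measurable]: "N i \<in> measurable M (count_space UNIV)" if "i \<in> I" for i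
    using indep that by (simp add: indep_vars_def)
  \<comment> \<open>\<open>C\<close> matches surrogate vertices, not the actual arrivals, so it
    depends on the outcome only through the counts. Restricting them to \<open>I\<close> makes the
    count vector extensional, hence an element of a countable set.\<close>
  define C where "C = (\<lambda>\<omega>. count_matching I J w (\<lambda>i\<in>I. N i \<omega>))"
  define m where "m = (\<lambda>i j \<omega>. real (match_count (C \<omega>) i j))"
  have C: "is_matching (SIGMA i:I. real ` {..<N i \<omega>}) J (C \<omega>)" for \<omega>
    using count_matching(1)[OF assms(1,2), of "\<lambda>i\<in>I. N i \<omega>" w]
    by (simp add: C_def cong: Sigma_cong)
  have m_meas [measurable]: "m i j \<in> borel_measurable M" for i j
    unfolding m_def C_def
    by (rule measurable_compose[OF measurable_restrict_count_space[OF assms(1) N_meas]]) auto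
  have weight: "max_matching_weight w (online_vertices I arr \<omega>) J = (\<Sum>i\<in>I. \<Sum>j\<in>J. w i j * m i j \<omega>)"
    if "\<omega> \<in> space M" for \<omega>
    unfolding online_vertices_def m_def C_def
    by (rule max_matching_weight_eq_count_matching) (use assms arrivals(1) that in \<open>auto simp: N_def\<close>)
  have m_row: "(\<Sum>j\<in>J. m i j \<omega>) \<le> real (N i \<omega>)" for i \<omega>
    using sum_match_count_offline_le[OF assms(2) _ C, of i \<omega>]
    by (simp add: m_def card_image flip: of_nat_sum)
  \<comment> \<open>The bound is written as 1 minus the indicator of no arrival with type in
    \<open>S\<close>, so that taking expectations yields the right-hand side of the
    constraint.\<close>
  have m_col: "(\<Sum>i\<in>S. m i j \<omega>) \<le> 1 - of_bool (\<forall>i\<in>S. N i \<omega> = 0)" if "S \<subseteq> I" for S j \<omega>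
  proof -
    have "finite S" using that assms(1) finite_subset by blast
    then have "(\<Sum>i\<in>S. match_count (C \<omega>) i j) \<le> of_bool (\<exists>i\<in>S. real ` {..<N i \<omega>} \<noteq> {})"
      by (rule sum_match_count_online_le[OF _ _ assms(2) C]) (use assms(1) in auto)
    then have "real (\<Sum>i\<in>S. match_count (C \<omega>) i j) \<le> real (of_bool (\<exists>i\<in>S. real ` {..<N i \<omega>} \<noteq> {}))"
      by (rule of_nat_mono)
    also have "\<dots> = 1 - of_bool (\<forall>i\<in>S. N i \<omega> = 0)"
      by (auto simp: lessThan_empty_iff)
    finally show ?thesis by (simp add: m_def)
  qed
  have m_nonneg: "m i j \<omega> \<ge> 0" for i j \<omega>
    by (simp add: m_def)
  have m_int [simp]: "integrable M (m i j)" if "i \<in> I" for i j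
  proof (rule integrable_const_bound[where B = 1])
    \<comment> \<open>The bound \<open>m_col\<close> for the singleton \<open>{i}\<close> makes
      \<open>m i j\<close> bounded, hence integrable on a probability space.\<close>
    have "m i j \<omega> \<le> 1" for \<omega>
      using m_col[of "{i}" j \<omega>] that by (auto simp: of_bool_def split: if_splits)
    then show "AE \<omega> in M. norm (m i j \<omega>) \<le> 1"
      using m_nonneg by simp
  qed simp
  define x where "x = (\<lambda>i j. expectation (m i j))"
  have "OPT M I J w arr = expectation (\<lambda>\<omega>. \<Sum>i\<in>I. \<Sum>j\<in>J. w i j * m i j \<omega>)"
    unfolding OPT_def by (rule Bochner_Integration.integral_cong) (simp_all add: weight)
  also have "\<dots> = (\<Sum>i\<in>I. \<Sum>j\<in>J. w i j * x i j)"
    by (simp add: x_def Bochner_Integration.integral_sum)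
  also have "\<dots> \<le> NAT I J lam w"
  proof (rule NAT_upper)
    show "NAT_feasible I J lam x"
      unfolding NAT_feasible_def
    proof (intro conjI ballI allI impI)
      fix i assume i: "i \<in> I"
      note mean = poisson_mean[OF N_meas[OF i] assms(4)[OF i] prob_N[OF i]]
      have "(\<Sum>j\<in>J. x i j) = expectation (\<lambda>\<omega>. \<Sum>j\<in>J. m i j \<omega>)"
        using i by (simp add: x_def)
      \<comment> \<open>The pointwise bound by the number of arrivals is integrated;
        \<open>poisson_mean\<close> supplies integrability of the majorant and its value
        \<open>lam i\<close>.\<close>
      also have "\<dots> \<le> expectation (\<lambda>\<omega>. real (N i \<omega>))"
        by (rule integral_mono) (use i mean m_row in auto)
      finally show "(\<Sum>j\<in>J. x i j) \<le> lam i"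
        using mean by simp
    next
      fix j S assume j: "j \<in> J" and S: "S \<subseteq> I"
      let ?Z = "{\<omega> \<in> space M. \<forall>i\<in>S. N i \<omega> = 0}"
      have "finite S" using S assms(1) finite_subset by blast
      have N_S: "N i \<in> measurable M (count_space UNIV)" if "i \<in> S" for i
        using that S N_meas by auto
      have Z [measurable]: "?Z \<in> sets M"
        using \<open>finite S\<close> N_S by measurable
      have Z_int: "integrable M (indicator ?Z :: 'a \<Rightarrow> real)"
        by (rule integrable_real_indicator[OF Z]) (simp add: emeasure_eq_measure)
      have "(\<Sum>i\<in>S. x i j) = expectation (\<lambda>\<omega>. \<Sum>i\<in>S. m i j \<omega>)"
        unfolding x_def by (rule Bochner_Integration.integral_sum[symmetric]) (use S in auto)
      also have "\<dots> \<le> expectation (\<lambda>\<omega>. 1 - indicator ?Z \<omega>)"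
      proof (rule integral_mono)
        show "integrable M (\<lambda>\<omega>. \<Sum>i\<in>S. m i j \<omega>)"
          using S by (intro Bochner_Integration.integrable_sum) auto
        fix \<omega> assume "\<omega> \<in> space M"
        then show "(\<Sum>i\<in>S. m i j \<omega>) \<le> 1 - indicator ?Z \<omega>"
          using m_col[OF S, of j \<omega>] by (simp add: indicator_def of_bool_def)
      qed (intro Bochner_Integration.integrable_diff integrable_const Z_int)
      also have "\<dots> = 1 - prob ?Z"
        using Z Z_int by (simp add: prob_space)
      also have "prob ?Z = exp (- (\<Sum>i\<in>S. lam i))"
        by (rule prob_all_zero[OF indep \<open>finite S\<close> S]) (use prob_N[of _ 0] S in auto)
      finally show "(\<Sum>i\<in>S. x i j) \<le> 1 - exp (- (\<Sum>i\<in>S. lam i))" .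
    next
      fix i j
      show "x i j \<ge> 0"
        unfolding x_def by (rule integral_nonneg_AE) (simp add: m_nonneg)
    qed
  qed (use assms in auto)
  finally show ?thesis .
qed

end
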